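(* For $n\ge3$ let $\mathcal A$ be the upper triangular $n\times n$ matrix with units on the diagonal and entries $G_{i,j}=-\operatorname{Tr}(\gamma_i\gamma_j)$ for $i<j$, where $\gamma_1,\dots,\gamma_n$ is the basis of the Fuchsian group of a disk with $n$ orbifold points in shear coordinates (see context). In the case $A_3^\ast$ ($n=3$, $Z_1=Z_2=Z_3=0$) and the case $A_4^\ast$ ($n=4$, $Z_1=-Z_2=Z_3=-Z_4=\frac{\log 2}{2}$, $Y=0$) the matrix $\mathcal A$ equals, respectively, $$\begin{pmatrix}1&3&3\\0&1&3\\0&0&1\end{pmatrix}\qquad\text{and}\qquad\begin{pmatrix}1&4&6&4\\0&1&4&6\\0&0&1&4\\0&0&0&1\end{pmatrix},$$ which coincide with the Stokes matrices of the quantum cohomology rings $H^\ast(\mathbb{CP}^2)$ and $H^\ast(\mathbb{CP}^3)$ respectively.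
   Context: Notation: $$F=\begin{pmatrix}0&1\\ -1&0\end{pmatrix},\quad R=\begin{pmatrix}1&1\\ -1&0\end{pmatrix},\quad L=\begin{pmatrix}0&1\\ -1&-1\end{pmatrix},\quad X_Z=\begin{pmatrix}0&-\exp(Z/2)\\ \exp(-Z/2)&0\end{pmatrix}.$$ The basis is, for $n=3$ (coordinates $Z_1,Z_2,Z_3$): $\gamma_1=F$, $\gamma_2=-X_{Z_1}LX_{Z_2}FX_{Z_2}RX_{Z_1}$, $\gamma_3=-X_{Z_1}RX_{Z_3}FX_{Z_3}LX_{Z_1}$; for $n=4$ (coordinates $Z_1,\dots,Z_4$ of the pending edges and $Y$ of the internal edge): $\gamma_1=F$, $\gamma_2=-X_{Z_1}LX_{Z_2}FX_{Z_2}RX_{Z_1}$, $\gamma_3=-X_{Z_1}RX_{Y}LX_{Z_3}FX_{Z_3}RX_{Y}LX_{Z_1}$, $\gamma_4=-X_{Z_1}RX_{Y}RX_{Z_4}FX_{Z_4}LX_{Y}LX_{Z_1}$. Known facts (Dubrovin, Guzzetti): the Stokes matrices associated with the Frobenius manifold structures on the quantum cohomology of $\mathbb{CP}^2$ and $\mathbb{CP}^3$ are the two displayed matrices. *)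

theory Defs
  imports
    Complex_Main
    "HOL-Library.Landau_Symbols"
    "Jordan_Normal_Form.Matrix"
begin

section \<open>The matrix of geodesic functions of a disk with orbifold points\<close>

definition mat_trace :: "'a::comm_monoid_add mat \<Rightarrow> 'a" where
  "mat_trace A = (\<Sum>i<dim_row A. A $$ (i, i))"

definition F_mat :: "real mat" where
  "F_mat = mat_of_rows_list 2 [[0, 1], [-1, 0]]"

definition R_mat :: "real mat" where
  "R_mat = mat_of_rows_list 2 [[1, 1], [-1, 0]]"

definition L_mat :: "real mat" where
  "L_mat = mat_of_rows_list 2 [[0, 1], [-1, -1]]"

definition X_mat :: "real \<Rightarrow> real mat" where
  "X_mat Z = mat_of_rows_list 2 [[0, - exp (Z / 2)], [exp (- Z / 2), 0]]"

text \<open>The bases of the Fuchsian group, as lists: the list entry with index \<open>i\<close> (counted from 0)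
  is the generator called \<open>\<gamma>\<close> with index \<open>i + 1\<close>.\<close>

definition fuchsian_basis3 :: "real \<Rightarrow> real \<Rightarrow> real \<Rightarrow> real mat list" where
  "fuchsian_basis3 Z1 Z2 Z3 =
    [F_mat,
     - (X_mat Z1 * L_mat * X_mat Z2 * F_mat * X_mat Z2 * R_mat * X_mat Z1),
     - (X_mat Z1 * R_mat * X_mat Z3 * F_mat * X_mat Z3 * L_mat * X_mat Z1)]"

definition fuchsian_basis4 :: "real \<Rightarrow> real \<Rightarrow> real \<Rightarrow> real \<Rightarrow> real \<Rightarrow> real mat list" where
  "fuchsian_basis4 Z1 Z2 Z3 Z4 Y =
    [F_mat,
     - (X_mat Z1 * L_mat * X_mat Z2 * F_mat * X_mat Z2 * R_mat * X_mat Z1),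
     - (X_mat Z1 * R_mat * X_mat Y * L_mat * X_mat Z3 * F_mat * X_mat Z3 * R_mat * X_mat Y
          * L_mat * X_mat Z1),
     - (X_mat Z1 * R_mat * X_mat Y * R_mat * X_mat Z4 * F_mat * X_mat Z4 * L_mat * X_mat Y
          * L_mat * X_mat Z1)]"

definition geodesic_matrix :: "real mat list \<Rightarrow> real mat" where
  "geodesic_matrix \<gamma> = mat (length \<gamma>) (length \<gamma>)
     (\<lambda>(i, j). if i = j then 1 else if i < j then - mat_trace (\<gamma> ! i * \<gamma> ! j) else 0)"


section \<open>Stokes matrices of the quantum cohomology of projective spaces\<close>

text \<open>Dubrovin's conventions.  At a semisimple point, a Frobenius manifold of dimension \<open>n\<close> with
  flat metric \<open>\<eta>\<close>, multiplication \<open>EE\<close> by the Euler field and grading operator \<open>\<mu>\<close> (all in flat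
  coordinates) gives the system \<open>d\<xi>/dz = (EE + \<mu>/z) \<xi>\<close>.  If the columns of \<open>P\<close> are
  \<open>\<eta>\<close>-orthonormal eigenvectors of \<open>EE\<close>, with eigenvalues \<open>u\<close> (the canonical coordinates), then
  \<open>\<xi> = P Y\<close> turns it into \<open>dY/dz = (U + V/z) Y\<close> with \<open>U = diag u\<close> and
  \<open>V = P\<^sup>-\<^sup>1 \<mu> P = P\<^sup>T \<eta> \<mu> P\<close>.  The matrix \<open>P\<close> is unique up to the signs of its columns.\<close>

definition sector :: "real \<Rightarrow> real \<Rightarrow> complex set" where
  "sector a b = {rcis r \<theta> |r \<theta>. 0 < r \<and> a < \<theta> \<and> \<theta> < b}"

definition solves_on ::
  "nat \<Rightarrow> (complex \<Rightarrow> complex mat) \<Rightarrow> complex set \<Rightarrow> (complex \<Rightarrow> complex mat) \<Rightarrow> bool" where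
  "solves_on n A D Y \<longleftrightarrow>
    (\<forall>z\<in>D. Y z \<in> carrier_mat n n \<and>
      (\<forall>i<n. \<forall>j<n. ((\<lambda>w. Y w $$ (i, j)) has_field_derivative (A z * Y z) $$ (i, j)) (at z)))"

text \<open>\<open>Y(z) = (1 + O(1/z)) exp (z U)\<close> as \<open>z\<close> tends to infinity in \<open>D\<close>.\<close>

definition canonical_asymp ::
  "nat \<Rightarrow> (nat \<Rightarrow> complex) \<Rightarrow> complex set \<Rightarrow> (complex \<Rightarrow> complex mat) \<Rightarrow> bool" where
  "canonical_asymp n u D Y \<longleftrightarrow>
    (\<forall>i<n. \<forall>j<n.
      (\<lambda>z. (Y z * mat_diag n (\<lambda>k. exp (- z * u k)) - 1\<^sub>m n) $$ (i, j))
        \<in> O[inf at_infinity (principal D)](\<lambda>z. 1 / z))"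

text \<open>The oriented line in the direction \<open>cis \<phi>\<close> is admissible (no \<open>Re (z (u i - u j))\<close> with
  \<open>i \<noteq> j\<close> vanishes on it), and the canonical coordinates are numbered in the order that makes the
  Stokes matrix upper triangular.  The solutions \<open>YR\<close> and \<open>YL\<close> live on sectors slightly wider than
  the half planes to the right and to the left of the line, and \<open>YL = YR S\<close> near its positive
  half.\<close>

definition stokes_matrix_at ::
  "nat \<Rightarrow> complex mat \<Rightarrow> complex mat \<Rightarrow> complex mat \<Rightarrow> complex mat \<Rightarrow> bool" where
  "stokes_matrix_at n \<eta> EE \<mu> S \<longleftrightarrow> S \<in> carrier_mat n n \<and>
    (\<exists>\<phi> \<epsilon> u P YR YL.
      0 < \<epsilon> \<and> \<epsilon> < pi / 2 \<and>
      (\<forall>i j. i < j \<and> j < n \<longrightarrow> Re (cis \<phi> * (u i - u j)) < 0) \<and>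
      P \<in> carrier_mat n n \<and>
      EE * P = P * mat_diag n u \<and>
      transpose_mat P * \<eta> * P = 1\<^sub>m n \<and>
      (let A = (\<lambda>z. mat_diag n u + (1 / z) \<cdot>\<^sub>m (transpose_mat P * \<eta> * \<mu> * P));
           DR = sector (\<phi> - pi - \<epsilon>) (\<phi> + \<epsilon>);
           DL = sector (\<phi> - \<epsilon>) (\<phi> + pi + \<epsilon>)
       in solves_on n A DR YR \<and> canonical_asymp n u DR YR \<and>
          solves_on n A DL YL \<and> canonical_asymp n u DL YL \<and>
          (\<forall>z\<in>sector (\<phi> - \<epsilon>) (\<phi> + \<epsilon>). YL z = YR z * S)))"

text \<open>A Stokes matrix of a Frobenius manifold depends on the admissible line, on the signs of the
  columns of \<open>P\<close> and on the semisimple chart; analytic continuation of the structure acts on it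
  through the braid group.  The generators are \<open>S \<mapsto> K S K\<close> with the matrix \<open>K\<close> below, and the
  Stokes matrix of the Frobenius manifold is understood modulo the braid group and the sign
  changes.\<close>

definition braid_mat :: "nat \<Rightarrow> nat \<Rightarrow> complex mat \<Rightarrow> complex mat" where
  "braid_mat n i S = mat n n (\<lambda>(a, b).
     if (a, b) = (i, i) then 0
     else if (a, b) = (i, Suc i) \<or> (a, b) = (Suc i, i) then 1
     else if (a, b) = (Suc i, Suc i) then - S $$ (i, Suc i)
     else if a = b then 1 else 0)"

inductive stokes_move :: "nat \<Rightarrow> complex mat \<Rightarrow> complex mat \<Rightarrow> bool" for n where
  braid: "S \<in> carrier_mat n n \<Longrightarrow> Suc i < n \<Longrightarrow>
    stokes_move n S (braid_mat n i S * S * braid_mat n i S)"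
| sign: "S \<in> carrier_mat n n \<Longrightarrow> (\<And>i. i < n \<Longrightarrow> e i = 1 \<or> e i = -1) \<Longrightarrow>
    stokes_move n S (mat_diag n e * S * mat_diag n e)"

text \<open>The quantum cohomology of the complex projective space of dimension \<open>d\<close> at the origin of
  \<open>H\<^sup>2\<close>, a semisimple point, in the basis \<open>1, x, \<dots>, x\<^sup>d\<close> of powers of the hyperplane class.  The
  algebra is \<open>\<complex>[x]/(x\<^sup>d\<^sup>+\<^sup>1 - 1)\<close>, the metric is the intersection pairing, and the Euler field is the
  first Chern class \<open>(d + 1) x\<close>.\<close>

definition qh_metric :: "nat \<Rightarrow> complex mat" where
  "qh_metric d = mat (d + 1) (d + 1) (\<lambda>(a, b). if a + b = d then 1 else 0)"

definition qh_euler_mult :: "nat \<Rightarrow> complex mat" where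
  "qh_euler_mult d = mat (d + 1) (d + 1)
     (\<lambda>(a, b). if a = (b + 1) mod (d + 1) then of_nat (d + 1) else 0)"

definition qh_grading :: "nat \<Rightarrow> complex mat" where
  "qh_grading d = mat_diag (d + 1) (\<lambda>a. of_nat a - of_nat d / 2)"

definition stokes_matrix_qh_CP :: "nat \<Rightarrow> complex mat \<Rightarrow> bool" where
  "stokes_matrix_qh_CP d S \<longleftrightarrow>
    (\<exists>S0. stokes_matrix_at (d + 1) (qh_metric d) (qh_euler_mult d) (qh_grading d) S0 \<and>
          equivclp (stokes_move (d + 1)) S0 S)"

end

theory Submission
  imports Defs
begin

text \<open>
  Since \<open>X\<^sub>Z\<inverse> = - X\<^sub>Z\<close> and \<open>R\<inverse> = - L\<close>, every generator has the form \<open>P F P\<inverse>\<close> where \<open>P\<close> is the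
  product of the matrices along the path from the base edge to an orbifold point. The path
  crosses each of its edges once on the way out and once on the way back, and the product
  \<open>X\<^sub>Z M X\<^sub>Z\<close> multiplies the entries of \<open>M\<close> by \<open>\<plusminus>1\<close> or \<open>\<plusminus> exp (\<plusminus> Z)\<close> and permutes them, so that the
  square roots \<open>exp (Z / 2)\<close> disappear; in particular \<open>X\<^sub>Z F X\<^sub>Z = X\<^bsub>2Z\<^esub>\<close> at the orbifold point.
  The generators are therefore rational in the exponentials of the shear coordinates; they are
  written out for arbitrary coordinates in \<open>gamma2_closed_form\<close>, \<open>gamma3_closed_form_disk3\<close>,
  \<open>gamma3_closed_form_disk4\<close> and \<open>gamma4_closed_form_disk4\<close>.

  At \<open>A\<^sub>3\<^sup>*\<close> all exponentials are \<open>1\<close>. At \<open>A\<^sub>4\<^sup>*\<close> they are \<open>1\<close>, \<open>\<surd>2\<close> or \<open>1 / \<surd>2\<close>, and the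
  resulting generators have integer off-diagonal entries and integer multiples of \<open>\<surd>2\<close> on the
  diagonal. The trace of a product of two of them is thus an integer, and the negatives of these
  integers are the entries above the diagonal of the Stokes matrices. As the matrices of geodesic functions are equal to the Stokes
  matrices, every property of the latter, such as being the Stokes matrix of the quantum
  cohomology, carries over.
\<close>

section \<open>Arithmetic of two by two matrices\<close>

definition mat2 :: "'a \<Rightarrow> 'a \<Rightarrow> 'a \<Rightarrow> 'a \<Rightarrow> 'a mat" where
  "mat2 a b c d = mat_of_rows_list 2 [[a, b], [c, d]]"

lemma mat2_cong:
  "a = a' \<Longrightarrow> b = b' \<Longrightarrow> c = c' \<Longrightarrow> d = d' \<Longrightarrow> mat2 a b c d = mat2 a' b' c' d'"
  by simp

lemma mat2_mult:
  fixes a b c d :: "'a::comm_semiring_0"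
  shows "mat2 a b c d * mat2 a' b' c' d' =
    mat2 (a * a' + b * c') (a * b' + b * d') (c * a' + d * c') (c * b' + d * d')"
  by (rule eq_matI)
    (auto simp: mat2_def mat_of_rows_list_def scalar_prod_def less_Suc_eq numeral_2_eq_2)

lemma mat2_uminus:
  fixes a b c d :: "'a::group_add"
  shows "- mat2 a b c d = mat2 (- a) (- b) (- c) (- d)"
  by (rule eq_matI) (auto simp: mat2_def mat_of_rows_list_def less_Suc_eq numeral_2_eq_2)

lemma mat_trace_mat2: "mat_trace (mat2 a b c d) = a + d"
  by (simp add: mat_trace_def mat2_def mat_of_rows_list_def numeral_2_eq_2)

lemma generator_mats_as_mat2:
  "F_mat = mat2 0 1 (- 1) 0"
  "R_mat = mat2 1 1 (- 1) 0"
  "L_mat = mat2 0 1 (- 1) (- 1)"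
  by (simp_all add: F_mat_def R_mat_def L_mat_def mat2_def)

lemma X_mat_as_mat2: "X_mat Z = mat2 0 (- exp (Z / 2)) (1 / exp (Z / 2)) 0"
  by (simp add: X_mat_def mat2_def exp_minus inverse_eq_divide)

text \<open>In terms of \<open>exp (Z / 2)\<close> both the products of the \<open>X\<^sub>Z\<close> and their closed forms are rational
  functions, so that their equality becomes a field identity.\<close>

lemma exp_eq_exp_half_squared: "exp (Z::real) = exp (Z / 2) * exp (Z / 2)"
  by (simp flip: exp_add)


section \<open>The generators in exponentiated shear coordinates\<close>

text \<open>The diagonal entries are opposite because conjugation preserves the vanishing trace of \<open>F\<close>;
  a trace-free matrix of determinant \<open>1\<close> is a rotation by \<open>\<pi>\<close> about a point of the hyperbolic
  plane, here the orbifold point.\<close>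

lemma gamma2_closed_form:
  fixes Z1 Z2 :: real
  defines "a \<equiv> exp Z1" and "b \<equiv> exp Z2"
  shows "- (X_mat Z1 * L_mat * X_mat Z2 * F_mat * X_mat Z2 * R_mat * X_mat Z1) =
    mat2 (- 1 / b) (a * (b + 1 / b)) (- 1 / (a * b)) (1 / b)"
  unfolding a_def b_def exp_eq_exp_half_squared[of Z1] exp_eq_exp_half_squared[of Z2]
    generator_mats_as_mat2 X_mat_as_mat2 mat2_mult mat2_uminus
  by (rule mat2_cong) (simp_all add: field_simps)

lemma gamma3_closed_form_disk3:
  fixes Z1 Z3 :: real
  defines "a \<equiv> exp Z1" and "c \<equiv> exp Z3"
  shows "- (X_mat Z1 * R_mat * X_mat Z3 * F_mat * X_mat Z3 * L_mat * X_mat Z1) =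
    mat2 (- c) (a * c) (- (c + 1 / c) / a) c"
  unfolding a_def c_def exp_eq_exp_half_squared[of Z1] exp_eq_exp_half_squared[of Z3]
    generator_mats_as_mat2 X_mat_as_mat2 mat2_mult mat2_uminus
  by (rule mat2_cong) (simp_all add: field_simps)

lemma gamma3_closed_form_disk4:
  fixes Z1 Z3 Y :: real
  defines "a \<equiv> exp Z1" and "c \<equiv> exp Z3" and "y \<equiv> exp Y"
  shows "- (X_mat Z1 * R_mat * X_mat Y * L_mat * X_mat Z3 * F_mat * X_mat Z3 * R_mat * X_mat Y
          * L_mat * X_mat Z1) =
    mat2 (- (y * (c + 1 / c) + 1 / c)) (a * y * (c + 1 / c))
      (- (2 / c + 1 / (c * y) + y * (c + 1 / c)) / a) (y * (c + 1 / c) + 1 / c)"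
  unfolding a_def c_def y_def exp_eq_exp_half_squared[of Z1] exp_eq_exp_half_squared[of Z3]
    exp_eq_exp_half_squared[of Y] generator_mats_as_mat2 X_mat_as_mat2 mat2_mult mat2_uminus
  by (rule mat2_cong) (simp_all add: field_simps)

lemma gamma4_closed_form_disk4:
  fixes Z1 Z4 Y :: real
  defines "a \<equiv> exp Z1" and "d \<equiv> exp Z4" and "y \<equiv> exp Y"
  shows "- (X_mat Z1 * R_mat * X_mat Y * R_mat * X_mat Z4 * F_mat * X_mat Z4 * L_mat * X_mat Y
          * L_mat * X_mat Z1) =
    mat2 (- (d + y * d)) (a * y * d) (- (2 * d + (d + 1 / d) / y + y * d) / a) (d + y * d)"
  unfolding a_def d_def y_def exp_eq_exp_half_squared[of Z1] exp_eq_exp_half_squared[of Z4]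
    exp_eq_exp_half_squared[of Y] generator_mats_as_mat2 X_mat_as_mat2 mat2_mult mat2_uminus
  by (rule mat2_cong) (simp_all add: field_simps)


section \<open>The symmetric points\<close>

lemma fuchsian_basis3_symmetric_point:
  "fuchsian_basis3 0 0 0 = [mat2 0 1 (- 1) 0, mat2 (- 1) 2 (- 1) 1, mat2 (- 1) 1 (- 2) 1]"
  unfolding fuchsian_basis3_def gamma2_closed_form gamma3_closed_form_disk3
  by (simp add: generator_mats_as_mat2(1))

lemma fuchsian_basis4_symmetric_point:
  "fuchsian_basis4 (ln 2 / 2) (- (ln 2 / 2)) (ln 2 / 2) (- (ln 2 / 2)) 0 =
    [mat2 0 1 (- 1) 0,
     mat2 (- sqrt 2) 3 (- 1) (sqrt 2),
     mat2 (- 2 * sqrt 2) 3 (- 3) (2 * sqrt 2),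
     mat2 (- sqrt 2) 1 (- 3) (sqrt 2)]"
proof -
  have e: "exp (ln 2 / 2 :: real) = sqrt 2"
    by (simp add: exp_eq_exp_half_squared[of "ln 2"] flip: ln_sqrt)
  show ?thesis
    unfolding fuchsian_basis4_def gamma2_closed_form gamma3_closed_form_disk4
      gamma4_closed_form_disk4 exp_minus e
    by (auto intro!: mat2_cong simp: generator_mats_as_mat2(1) field_simps)
qed

lemma geodesic_matrix3_symmetric_point:
  "geodesic_matrix (fuchsian_basis3 0 0 0) =
    mat_of_rows_list 3 [[1, 3, 3], [0, 1, 3], [0, 0, 1]]"
  unfolding fuchsian_basis3_symmetric_point
  by (rule eq_matI)
    (auto simp: geodesic_matrix_def mat_of_rows_list_def mat2_mult mat_trace_mat2
      less_Suc_eq numeral_3_eq_3)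

text \<open>For trace-free generators with diagonals \<open>(p, - p)\<close> and \<open>(p', - p')\<close> the trace of the product
  is \<open>2 p p' + q r' + r q'\<close>, where \<open>q, r\<close> and \<open>q', r'\<close> are the off-diagonal entries. The diagonals
  enter only through \<open>p p'\<close>, where two factors \<open>\<surd>2\<close> combine to \<open>2\<close>.\<close>

lemma geodesic_matrix4_symmetric_point:
  "geodesic_matrix (fuchsian_basis4 (ln 2 / 2) (- (ln 2 / 2)) (ln 2 / 2) (- (ln 2 / 2)) 0) =
    mat_of_rows_list 4 [[1, 4, 6, 4], [0, 1, 4, 6], [0, 0, 1, 4], [0, 0, 0, 1]]"
  unfolding fuchsian_basis4_symmetric_point
  by (rule eq_matI)
    (auto simp: geodesic_matrix_def mat_of_rows_list_def mat2_mult mat_trace_mat2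
      less_Suc_eq numeral_eq_Suc)

theorem theorem8p7:
  shows "(let A3 = geodesic_matrix (fuchsian_basis3 0 0 0);
              S3 = mat_of_rows_list 3 [[1, 3, 3], [0, 1, 3], [0, 0, 1]]
          in A3 = S3 \<and>
             (stokes_matrix_qh_CP 2 (map_mat complex_of_real S3) \<longrightarrow>
              stokes_matrix_qh_CP 2 (map_mat complex_of_real A3)))
       \<and> (let A4 = geodesic_matrix
                (fuchsian_basis4 (ln 2 / 2) (- (ln 2 / 2)) (ln 2 / 2) (- (ln 2 / 2)) 0);
              S4 = mat_of_rows_list 4 [[1, 4, 6, 4], [0, 1, 4, 6], [0, 0, 1, 4], [0, 0, 0, 1]]
          in A4 = S4 \<and>
             (stokes_matrix_qh_CP 3 (map_mat complex_of_real S4) \<longrightarrow>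
              stokes_matrix_qh_CP 3 (map_mat complex_of_real A4)))"
  unfolding Let_def geodesic_matrix3_symmetric_point geodesic_matrix4_symmetric_point
  by simp

end
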